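(* Let $X$ be a topological space. The following properties are equivalent: (1) $X$ is normal. (2) For any disjoint closed sets $A$ and $B$ of $X$, there exist disjoint $Q^*g$-open sets $U$ and $V$ of $X$ such that $A\subset U$ and $B\subset V$. (3) For any closed set $A$ of $X$ and any open set $V$ of $X$ containing $A$, there exists a $Q^*g$-open set $U$ of $X$ such that $A\subset U\subset cl(U)\subset V$.
   Context: No separation axioms are assumed on topological spaces. The symbol $\subset$ denotes (not necessarily proper) inclusion; $cl(A)$ and $int(A)$ denote closure and interior. A space is normal if any two disjoint closed sets are contained in disjoint open sets (no $T_1$ assumption). A subset $A$ of $X$ is $Q^*$-closed if $A$ is closed and $int(A)=\emptyset$; $A$ is $Q^*$-open if $X-A$ is $Q^*$-closed. A subset $A$ of $X$ is $Q^*g$-closed if $cl(A)\subset W$ whenever $A\subset W$ and $W$ is $Q^*$-open in $X$; $A$ is $Q^*g$-open if $X-A$ is $Q^*g$-closed. *)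

theory Defs
  imports "HOL-Analysis.Analysis"
begin

text \<open>
  The underlying set of an abstract topology is its \<open>topspace\<close>, which need not be the
  whole type. A subset of the space is thus a set contained in \<open>topspace X\<close>, and
  complements are taken relative to \<open>topspace X\<close>.
\<close>

definition Qstar_closedin :: "'a topology \<Rightarrow> 'a set \<Rightarrow> bool"
  where "Qstar_closedin X A \<longleftrightarrow> closedin X A \<and> X interior_of A = {}"

definition Qstar_openin :: "'a topology \<Rightarrow> 'a set \<Rightarrow> bool"
  where "Qstar_openin X A \<longleftrightarrow> A \<subseteq> topspace X \<and> Qstar_closedin X (topspace X - A)"

definition Qstar_g_closedin :: "'a topology \<Rightarrow> 'a set \<Rightarrow> bool"
  where "Qstar_g_closedin X A \<longleftrightarrow>
    A \<subseteq> topspace X \<and> (\<forall>W. Qstar_openin X W \<and> A \<subseteq> W \<longrightarrow> X closure_of A \<subseteq> W)"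

definition Qstar_g_openin :: "'a topology \<Rightarrow> 'a set \<Rightarrow> bool"
  where "Qstar_g_openin X A \<longleftrightarrow> A \<subseteq> topspace X \<and> Qstar_g_closedin X (topspace X - A)"

end

theory Submission
  imports Defs
begin

text \<open>
  The \<open>Q\<^sup>*\<close>-open sets are the dense open sets. A \<open>Q\<^sup>*g\<close>-open set \<open>U\<close> need not be open, but every
  closed \<open>A \<subseteq> U\<close> already lies in the interior of \<open>U\<close>: the interior of \<open>A\<close> does, and the
  rest of \<open>A\<close> is a \<open>Q\<^sup>*\<close>-closed set, to which the definition applies. Hence \<open>Q\<^sup>*g\<close>-open sets can be
  replaced by their interiors in the separation properties.
\<close>

text \<open>The complement of \<open>U\<close> equals its own closure, so every set containing the
  one contains the other.\<close>

lemma openin_imp_Qstar_g_openin: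
  assumes "openin X U"
  shows "Qstar_g_openin X U"
  using assms
  by (simp add: Qstar_g_openin_def Qstar_g_closedin_def openin_subset openin_closedin_eq
      closure_of_closedin)

text \<open>Any open subset of the difference is an open subset of \<open>A\<close>, hence lies in
  \<open>X interior_of A\<close>, which has just been removed.\<close>

lemma Qstar_closedin_diff_interior_of:
  assumes "closedin X A"
  shows "Qstar_closedin X (A - X interior_of A)"
proof -
  have "X interior_of (A - X interior_of A) \<subseteq> X interior_of A"
    by (rule interior_of_mono) blast
  moreover have "X interior_of (A - X interior_of A) \<subseteq> A - X interior_of A"
    by (rule interior_of_subset)
  ultimately show ?thesis
    using assms by (auto simp: Qstar_closedin_def closedin_diff)
qed

lemma closedin_subset_interior_of_Qstar_g_openin:
  assumes U: "Qstar_g_openin X U" and A: "closedin X A" and "A \<subseteq> U"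
  shows "A \<subseteq> X interior_of U"
proof -
  define F where "F = A - X interior_of A"
  have "F \<subseteq> topspace X"
    using closedin_subset[OF A] by (auto simp: F_def)
  \<comment> \<open>The complement of \<open>F\<close> serves as the test set \<open>W\<close> in
    the definition of \<open>Qstar_g_closedin\<close> for \<open>topspace X - U\<close>.\<close>
  then have "Qstar_openin X (topspace X - F)"
    using Qstar_closedin_diff_interior_of[OF A]
    by (simp add: Qstar_openin_def F_def double_diff)
  moreover have "topspace X - U \<subseteq> topspace X - F"
    using \<open>A \<subseteq> U\<close> by (auto simp: F_def)
  ultimately have "X closure_of (topspace X - U) \<subseteq> topspace X - F"
    using U by (simp add: Qstar_g_openin_def Qstar_g_closedin_def)
  \<comment> \<open>Taking complements turns the bound on the closure of
    \<open>topspace X - U\<close> into one on the interior of \<open>U\<close>.\<close>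
  then have "F \<subseteq> X interior_of U"
    using \<open>F \<subseteq> topspace X\<close> by (auto simp: interior_of_closure_of)
  moreover have "X interior_of A \<subseteq> X interior_of U"
    using \<open>A \<subseteq> U\<close> by (rule interior_of_mono)
  ultimately show ?thesis
    by (auto simp: F_def)
qed

lemma normal_space_iff_Qstar_g_openin_separation:
  "normal_space X \<longleftrightarrow>
    (\<forall>A B. closedin X A \<and> closedin X B \<and> disjnt A B \<longrightarrow>
      (\<exists>U V. Qstar_g_openin X U \<and> Qstar_g_openin X V \<and> disjnt U V \<and> A \<subseteq> U \<and> B \<subseteq> V))"
    (is "_ \<longleftrightarrow> ?sep")
proof
  assume "normal_space X"
  then show ?sep
    unfolding normal_space_def by (meson openin_imp_Qstar_g_openin)
next
  assume sep: ?sep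
  show "normal_space X"
    unfolding normal_space_def
  proof (intro allI impI)
    fix A B assume AB: "closedin X A \<and> closedin X B \<and> disjnt A B"
    then obtain U V where UV: "Qstar_g_openin X U" "Qstar_g_openin X V" "disjnt U V" "A \<subseteq> U" "B \<subseteq> V"
      using sep by meson
    \<comment> \<open>The interiors are the open witnesses: they still contain \<open>A\<close> and
      \<open>B\<close>, because these are closed.\<close>
    have "disjnt (X interior_of U) (X interior_of V)"
      using \<open>disjnt U V\<close> by (meson disjnt_subset1 disjnt_subset2 interior_of_subset)
    then show "\<exists>U V. openin X U \<and> openin X V \<and> A \<subseteq> U \<and> B \<subseteq> V \<and> disjnt U V"
      using AB UV closedin_subset_interior_of_Qstar_g_openin openin_interior_of by meson
  qed
qed

text \<open>The criterion \<open>normal_space_alt\<close> asks for an open \<open>U\<close>; passing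
  to the interior keeps \<open>A\<close> inside and can only shrink the closure.\<close>

lemma normal_space_iff_Qstar_g_openin_shrinking:
  "normal_space X \<longleftrightarrow>
    (\<forall>A V. closedin X A \<and> openin X V \<and> A \<subseteq> V \<longrightarrow>
      (\<exists>U. Qstar_g_openin X U \<and> A \<subseteq> U \<and> U \<subseteq> X closure_of U \<and> X closure_of U \<subseteq> V))"
    (is "_ \<longleftrightarrow> ?shrink")
proof
  assume "normal_space X"
  then show ?shrink
    unfolding normal_space_alt
    by (meson openin_imp_Qstar_g_openin closure_of_subset openin_subset)
next
  assume shrink: ?shrink
  show "normal_space X"
    unfolding normal_space_alt
  proof (intro allI impI)
    fix A V assume AV: "closedin X A \<and> openin X V \<and> A \<subseteq> V"
    then obtain U where U: "Qstar_g_openin X U" "A \<subseteq> U" "X closure_of U \<subseteq> V"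
      using shrink by meson
    have "X closure_of (X interior_of U) \<subseteq> X closure_of U"
      by (intro closure_of_mono interior_of_subset)
    then show "\<exists>U. openin X U \<and> A \<subseteq> U \<and> X closure_of U \<subseteq> V"
      using AV U closedin_subset_interior_of_Qstar_g_openin openin_interior_of
      by (meson subset_trans)
  qed
qed

theorem theorem2p9:
  fixes X :: "'a topology"
  shows "(normal_space X \<longleftrightarrow>
          (\<forall>A B. closedin X A \<and> closedin X B \<and> disjnt A B \<longrightarrow>
            (\<exists>U V. Qstar_g_openin X U \<and> Qstar_g_openin X V \<and> disjnt U V \<and> A \<subseteq> U \<and> B \<subseteq> V)))
       \<and> (normal_space X \<longleftrightarrow>
          (\<forall>A V. closedin X A \<and> openin X V \<and> A \<subseteq> V \<longrightarrow>
            (\<exists>U. Qstar_g_openin X U \<and> A \<subseteq> U \<and> U \<subseteq> X closure_of U \<and> X closure_of U \<subseteq> V)))"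
  using normal_space_iff_Qstar_g_openin_separation normal_space_iff_Qstar_g_openin_shrinking
  by (rule conjI)

end
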